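(* Let $C_n,D_n\in\mathcal F$ be almost surely convergent sequences of sets, i.e., $\operatorname{as-lim}_n C_n=C$ and $\operatorname{as-lim}_n D_n=D$, and let $\Psi_n$ be an almost surely convergent (in the Frobenius norm) sequence of matrices or scalars, i.e., $\operatorname{as-lim}_n\Psi_n=\Psi$. If there exists a deterministic $D_0\in\mathcal K$ such that $D_n\subseteq D_0$ almost surely, then: (a) $\operatorname{as-lim}_n (C_n\oplus D_n)=C\oplus D$; (b) $\operatorname{as-lim\,sup}_n (C_n\ominus D_n)\subseteq C\ominus D$, when $D\neq\emptyset$; (c) $\operatorname{as-lim}_n \Psi_n\cdot D_n=\Psi\cdot D$; (d) $\operatorname{as-lim}_n \Psi_n^{-1}D_n=\Psi^{-1}D$, when $\Psi$ is invertible.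
   Context: $(\Omega,\mathfrak F,\mathbb P)$ is a complete probability space; $\mathcal F$ and $\mathcal K$ are the spaces of closed and compact subsets of a Euclidean space $E$; $C_n,D_n$ are random sets (maps $\Omega\to\mathcal F$ measurable for the Borel $\sigma$-algebra on $\mathcal F$). Matrices have dimensions compatible with the products. $C\oplus D=\{c+d:c\in C,d\in D\}$ (Minkowski sum); $C\ominus D=\{x: x\oplus D\subseteq C\}$ (Minkowski difference); $\Psi\cdot C=\{\Psi\cdot c:c\in C\}$; $\Psi^{-1}C=\{\Psi^{-1}\cdot c:c\in C\}$. Set limits: $\limsup_n C_n = \{x : \exists n_k \text{ s.t. } x_{n_k}\to x \text{ with } x_{n_k}\in C_{n_k}\}$, $\liminf_n C_n = \{x : \exists x_n\to x \text{ with } x_n\in C_n\}$, and $\lim_n C_n$ exists when these are equal, in which case it is their common value. $\operatorname{as-lim\,sup}_n C_n\subseteq C$ means $\mathbb P(\limsup_n C_n\subseteq C)=1$; $\operatorname{as-lim}_n C_n=C$ means $\mathbb P(\lim_n C_n=C)=1$ (and likewise for matrices or scalars with the usual limit). *)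

theory Defs
  imports "HOL-Probability.Probability" "HOL-Library.Set_Algebras"
begin

text \<open>Random closed sets. The space of closed sets (the empty set included) carries the Fell
  topology, generated by the sets of all closed F that miss a given compact K and the sets of all
  closed F that hit a given open G.\<close>

definition fell_topology :: "'a::topological_space set topology" where
  "fell_topology = topology_generated_by
     ({{F. closed F \<and> F \<inter> K = {}} |K. compact K} \<union> {{F. closed F \<and> F \<inter> G \<noteq> {}} |G. open G})"

lemma topspace_fell_topology: "topspace fell_topology = {F. closed F}"
proof
  show "topspace fell_topology \<subseteq> {F. closed F}"
    unfolding fell_topology_def topology_generated_by_topspace by (rule Union_least) auto
  have "{F :: 'a set. closed F} \<in> {{F. closed F \<and> F \<inter> K = {}} |K. compact K}"
    by (rule CollectI, rule exI[of _ "{}"]) simp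
  then show "{F :: 'a set. closed F} \<subseteq> topspace fell_topology"
    unfolding fell_topology_def topology_generated_by_topspace by (intro Union_upper UnI1)
qed

definition fell_borel :: "'a::topological_space set measure" where
  "fell_borel = sigma {F. closed F} {U. openin fell_topology U}"

definition random_closed_set :: "'w measure \<Rightarrow> ('w \<Rightarrow> 'a::topological_space set) \<Rightarrow> bool" where
  "random_closed_set M X \<longleftrightarrow> X \<in> M \<rightarrow>\<^sub>M fell_borel"

text \<open>The Minkowski sum is the library's sum of sets from \<^theory>\<open>HOL-Library.Set_Algebras\<close>.\<close>

definition minkowski_diff :: "'a::plus set \<Rightarrow> 'a set \<Rightarrow> 'a set" (infixl \<open>\<ominus>\<close> 65) where
  "C \<ominus> D = {x. {x} + D \<subseteq> C}"

definition set_limsup :: "(nat \<Rightarrow> 'a::topological_space set) \<Rightarrow> 'a set" where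
  "set_limsup C = {x. \<exists>r y. strict_mono r \<and> (\<forall>k. y k \<in> C (r k)) \<and> y \<longlonglongrightarrow> x}"

definition set_liminf :: "(nat \<Rightarrow> 'a::topological_space set) \<Rightarrow> 'a set" where
  "set_liminf C = {x. \<exists>y. (\<forall>n. y n \<in> C n) \<and> y \<longlonglongrightarrow> x}"

definition set_lim :: "(nat \<Rightarrow> 'a::topological_space set) \<Rightarrow> 'a set \<Rightarrow> bool" where
  "set_lim C L \<longleftrightarrow> set_liminf C = L \<and> set_limsup C = L"

text \<open>In the three definitions below, the measure of a non-measurable set is 0 by convention, so
  probability 1 entails that the set in question is an event.\<close>

definition as_set_lim ::
    "'w measure \<Rightarrow> (nat \<Rightarrow> 'w \<Rightarrow> 'a::topological_space set) \<Rightarrow> ('w \<Rightarrow> 'a set) \<Rightarrow> bool" where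
  "as_set_lim M C L \<longleftrightarrow> \<P>(\<omega> in M. set_lim (\<lambda>n. C n \<omega>) (L \<omega>)) = 1"

definition as_set_limsup_subset ::
    "'w measure \<Rightarrow> (nat \<Rightarrow> 'w \<Rightarrow> 'a::topological_space set) \<Rightarrow> ('w \<Rightarrow> 'a set) \<Rightarrow> bool" where
  "as_set_limsup_subset M C L \<longleftrightarrow> \<P>(\<omega> in M. set_limsup (\<lambda>n. C n \<omega>) \<subseteq> L \<omega>) = 1"

text \<open>On matrices, the norm (hence the topology) of the type is the Frobenius norm.\<close>

definition as_lim ::
    "'w measure \<Rightarrow> (nat \<Rightarrow> 'w \<Rightarrow> 'b::topological_space) \<Rightarrow> ('w \<Rightarrow> 'b) \<Rightarrow> bool" where
  "as_lim M X L \<longleftrightarrow> \<P>(\<omega> in M. (\<lambda>n. X n \<omega>) \<longlonglongrightarrow> L \<omega>) = 1"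

text \<open>If the limit of a sequence of matrices or scalars is invertible, its terms are invertible from
  some index on. The values of \<^const>\<open>matrix_inv\<close> and \<^const>\<open>inverse\<close> at the finitely many other
  terms affect neither the lower nor the upper limit of the image sets, as these are nonempty
  exactly when the original sets are.\<close>

end

theory Submission
  imports Defs
begin

text \<open>
  By completeness of the measure space, each of the almost sure convergence statements is equivalent
  to an \<open>AE\<close> statement, so it suffices to argue for a fixed sample point. A lower limit is always
  contained in the upper limit, so convergence to \<open>L\<close> amounts to \<open>L \<subseteq> lim inf\<close> and
  \<open>lim sup \<subseteq> L\<close>. The first inclusion is continuity of the operation. For the second one,
  the points chosen from the sets \<open>D n\<close> lie in a fixed compact set, so along a further
  subsequence they converge, which for sums forces the summands from \<open>C n\<close> to converge as well.
  Inverse images reduce to images, since by Cramer's rule the inverse depends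
  continuously on the matrix.
\<close>

text \<open>A set that is not an event has measure 0, so probability 1 already forces measurability.
  Conversely, the exceptional set lies in a null set, and completeness makes it an event.\<close>

lemma (in prob_space) prob_Collect_eq_1_iff_AE:
  assumes "complete_measure M"
  shows "\<P>(\<omega> in M. P \<omega>) = 1 \<longleftrightarrow> (AE \<omega> in M. P \<omega>)"
proof
  assume *: "\<P>(\<omega> in M. P \<omega>) = 1"
  then have "{\<omega> \<in> space M. P \<omega>} \<in> events"
    using measure_notin_sets by fastforce
  with * show "AE \<omega> in M. P \<omega>"
    by (simp add: prob_Collect_eq_1)
next
  assume *: "AE \<omega> in M. P \<omega>"
  then obtain N where N: "{\<omega> \<in> space M. \<not> P \<omega>} \<subseteq> N" "N \<in> null_sets M"
    by (auto elim!: AE_E simp: null_sets_def)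
  then have "{\<omega> \<in> space M. \<not> P \<omega>} \<in> events"
    using complete_measure.complete[OF assms] by blast
  moreover have "{\<omega> \<in> space M. P \<omega>} = space M - {\<omega> \<in> space M. \<not> P \<omega>}"
    by blast
  ultimately have "{\<omega> \<in> space M. P \<omega>} \<in> events"
    by simp
  with * show "\<P>(\<omega> in M. P \<omega>) = 1"
    by (simp add: prob_Collect_eq_1)
qed

lemma set_liminf_subset_set_limsup: "set_liminf A \<subseteq> set_limsup A"
  unfolding set_liminf_def set_limsup_def using strict_mono_id by fastforce

lemma set_liminfI: "(\<And>n. y n \<in> A n) \<Longrightarrow> y \<longlonglongrightarrow> x \<Longrightarrow> x \<in> set_liminf A"
  unfolding set_liminf_def by auto

lemma set_limsupI:
  "strict_mono r \<Longrightarrow> (\<And>k. y k \<in> A (r k)) \<Longrightarrow> y \<longlonglongrightarrow> x \<Longrightarrow> x \<in> set_limsup A"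
  unfolding set_limsup_def by auto

lemma set_limI:
  assumes "L \<subseteq> set_liminf A" and "set_limsup A \<subseteq> L"
  shows "set_lim A L"
  using assms set_liminf_subset_set_limsup[of A] by (auto simp: set_lim_def)

text \<open>The compact bound keeps the two summands from escaping to infinity in opposite
  directions: for the real sets {n} and {-n} both limits are empty, although every sum is
  {0}.\<close>

lemma set_lim_plus:
  fixes A B :: "nat \<Rightarrow> 'a::real_normed_vector set"
  assumes A: "set_lim A L" and B: "set_lim B L'" and K: "compact K" "\<And>n. B n \<subseteq> K"
  shows "set_lim (\<lambda>n. A n + B n) (L + L')"
proof (rule set_limI)
  show "L + L' \<subseteq> set_liminf (\<lambda>n. A n + B n)"
  proof
    fix x assume "x \<in> L + L'"
    then obtain a b where x: "x = a + b" "a \<in> set_liminf A" "b \<in> set_liminf B"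
      using A B by (auto simp: set_lim_def elim: set_plus_elim)
    then obtain u v where "\<And>n. u n \<in> A n" "u \<longlonglongrightarrow> a" "\<And>n. v n \<in> B n" "v \<longlonglongrightarrow> b"
      by (auto simp: set_liminf_def)
    then have 1: "\<And>n. u n + v n \<in> A n + B n" and 2: "(\<lambda>n. u n + v n) \<longlonglongrightarrow> x"
      by (auto simp: x intro: tendsto_add set_plus_intro)
    show "x \<in> set_liminf (\<lambda>n. A n + B n)"
      by (rule set_liminfI[OF 1 2])
  qed
  show "set_limsup (\<lambda>n. A n + B n) \<subseteq> L + L'"
  proof
    fix x assume "x \<in> set_limsup (\<lambda>n. A n + B n)"
    then obtain r y where r: "strict_mono r" and y: "\<And>k. y k \<in> A (r k) + B (r k)" "y \<longlonglongrightarrow> x"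
      by (auto simp: set_limsup_def)
    from y(1) have "\<exists>u v. u \<in> A (r k) \<and> v \<in> B (r k) \<and> y k = u + v" for k
      by (blast elim: set_plus_elim)
    then obtain u v where uv: "\<And>k. u k \<in> A (r k)" "\<And>k. v k \<in> B (r k)" "\<And>k. y k = u k + v k"
      by metis
    \<comment> \<open>All \<open>v k\<close> lie in \<open>K\<close>, so a second extraction
      \<open>s\<close> makes them converge; in terms of the original index the points then run along
      \<open>r \<circ> s\<close>.\<close>
    with K obtain b s where s: "strict_mono s" and v: "(v \<circ> s) \<longlonglongrightarrow> b"
      by (metis compact_imp_seq_compact seq_compactE subsetD)
    have rs: "strict_mono (r \<circ> s)"
      using r s by (rule strict_mono_o)
    \<comment> \<open>Sums and second summands both converge along \<open>s\<close>, hence so do the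
      first summands, being their differences.\<close>
    have "(\<lambda>k. y (s k) - v (s k)) \<longlonglongrightarrow> x - b"
      using LIMSEQ_subseq_LIMSEQ[OF y(2) s] v by (auto simp: o_def intro: tendsto_diff)
    then have "(u \<circ> s) \<longlonglongrightarrow> x - b"
      by (simp add: uv o_def)
    then have "x - b \<in> set_limsup A"
      by (rule set_limsupI[OF rs, rotated]) (simp add: uv)
    moreover have "b \<in> set_limsup B"
      by (rule set_limsupI[OF rs _ v]) (simp add: uv)
    ultimately have "x - b + b \<in> L + L'"
      using A B unfolding set_lim_def by (blast intro: set_plus_intro)
    then show "x \<in> L + L'"
      by simp
  qed
qed

text \<open>A point of the lower limit of \<open>B\<close> is approached by a full sequence, which
  can be restricted to the subsequence \<open>r\<close> given by the upper limit on the left. A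
  point of the upper limit of \<open>B\<close> might be approached only along indices that avoid
  \<open>r\<close>.\<close>

lemma set_limsup_minkowski_diff:
  fixes A B :: "nat \<Rightarrow> 'a::real_normed_vector set"
  shows "set_limsup (\<lambda>n. A n \<ominus> B n) \<subseteq> set_limsup A \<ominus> set_liminf B"
proof
  fix x assume "x \<in> set_limsup (\<lambda>n. A n \<ominus> B n)"
  then obtain r y where r: "strict_mono r" and y: "\<And>k. y k \<in> A (r k) \<ominus> B (r k)" "y \<longlonglongrightarrow> x"
    by (auto simp: set_limsup_def)
  have "x + b \<in> set_limsup A" if "b \<in> set_liminf B" for b
  proof -
    from that obtain v where v: "\<And>n. v n \<in> B n" "v \<longlonglongrightarrow> b"
      by (auto simp: set_liminf_def)
    have "(\<lambda>k. y k + v (r k)) \<longlonglongrightarrow> x + b"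
      using y(2) LIMSEQ_subseq_LIMSEQ[OF v(2) r] by (auto simp: o_def intro: tendsto_add)
    moreover have "y k + v (r k) \<in> A (r k)" for k
      using y(1)[of k] v(1)[of "r k"] by (auto simp: minkowski_diff_def set_plus_def)
    ultimately show ?thesis
      by (intro set_limsupI[OF r])
  qed
  then show "x \<in> set_limsup A \<ominus> set_liminf B"
    by (auto simp: minkowski_diff_def set_plus_def)
qed

text \<open>Bilinearity covers matrices and scalars at once, through joint continuity of the
  product. The compact bound matters because the limit factor \<open>l\<close> may be degenerate:
  the scalars 1/(n+1) map {n+1} to {1}, whereas the sets {n+1} have empty limit.\<close>

lemma (in bounded_bilinear) set_lim_image:
  assumes f: "f \<longlonglongrightarrow> l" and B: "set_lim B L" and K: "compact K" "\<And>n. B n \<subseteq> K"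
  shows "set_lim (\<lambda>n. prod (f n) ` B n) (prod l ` L)"
proof (rule set_limI)
  show "prod l ` L \<subseteq> set_liminf (\<lambda>n. prod (f n) ` B n)"
  proof
    fix x assume "x \<in> prod l ` L"
    then obtain b where x: "x = prod l b" "b \<in> set_liminf B"
      using B by (auto simp: set_lim_def)
    then obtain v where "\<And>n. v n \<in> B n" "v \<longlonglongrightarrow> b"
      by (auto simp: set_liminf_def)
    then have 1: "\<And>n. prod (f n) (v n) \<in> prod (f n) ` B n" and 2: "(\<lambda>n. prod (f n) (v n)) \<longlonglongrightarrow> x"
      using f by (auto simp: x intro: tendsto)
    show "x \<in> set_liminf (\<lambda>n. prod (f n) ` B n)"
      by (rule set_liminfI[OF 1 2])
  qed
  show "set_limsup (\<lambda>n. prod (f n) ` B n) \<subseteq> prod l ` L"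
  proof
    fix x assume "x \<in> set_limsup (\<lambda>n. prod (f n) ` B n)"
    then obtain r y where r: "strict_mono r"
      and y: "\<And>k. y k \<in> prod (f (r k)) ` B (r k)" "y \<longlonglongrightarrow> x"
      by (auto simp: set_limsup_def)
    from y(1) have "\<exists>v. v \<in> B (r k) \<and> y k = prod (f (r k)) v" for k
      by blast
    then obtain v where v: "\<And>k. v k \<in> B (r k)" "\<And>k. y k = prod (f (r k)) (v k)"
      by metis
    with K obtain b s where s: "strict_mono s" and b: "(v \<circ> s) \<longlonglongrightarrow> b"
      by (metis compact_imp_seq_compact seq_compactE subsetD)
    have rs: "strict_mono (r \<circ> s)"
      using r s by (rule strict_mono_o)
    have "(\<lambda>k. prod (f (r (s k))) (v (s k))) \<longlonglongrightarrow> prod l b"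
      using LIMSEQ_subseq_LIMSEQ[OF f rs] b by (auto simp: o_def intro: tendsto)
    moreover have "(\<lambda>k. y (s k)) \<longlonglongrightarrow> x"
      using LIMSEQ_subseq_LIMSEQ[OF y(2) s] by (simp add: o_def)
    \<comment> \<open>By the choice of \<open>v\<close>, both limits are limits of the same sequence
      \<open>y \<circ> s\<close>.\<close>
    ultimately have "x = prod l b"
      using LIMSEQ_unique by (auto simp: v)
    moreover have "b \<in> set_limsup B"
      by (rule set_limsupI[OF rs _ b]) (simp add: v)
    ultimately show "x \<in> prod l ` L"
      using B by (auto simp: set_lim_def)
  qed
qed

text \<open>In finite dimension every bilinear map is bounded, so only algebraic identities have to
  be checked.\<close>

lemma bounded_bilinear_matrix_vector_mult:
  "bounded_bilinear ((*v) :: real ^ 'n ^ 'm \<Rightarrow> real ^ 'n \<Rightarrow> real ^ 'm)"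
  unfolding bilinear_conv_bounded_bilinear[symmetric] bilinear_def
  by (auto intro!: linearI simp: algebra_simps matrix_vector_mult_add_rdistrib
      scaleR_matrix_vector_assoc matrix_vector_mult_scaleR)

lemma tendsto_det:
  fixes A :: "'b \<Rightarrow> real ^ 'n ^ 'n"
  assumes "(A \<longlongrightarrow> L) F"
  shows "((\<lambda>x. det (A x)) \<longlongrightarrow> det L) F"
  unfolding det_def by (intro tendsto_intros assms)

text \<open>Column \<open>l\<close> of the inverse solves the linear system whose right-hand side is
  the basis vector \<open>axis l 1\<close>; Cramer's rule gives its entry \<open>k\<close>.\<close>

lemma matrix_inv_nth:
  fixes A :: "real ^ 'n ^ 'n"
  assumes "invertible A"
  shows "matrix_inv A $ k $ l =
    det (\<chi> i j. if j = k then axis l 1 $ i else A $ i $ j) / det A"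
proof -
  have "A ** matrix_inv A = mat 1"
    \<comment> \<open>\<open>matrix_inv\<close> is defined by choice, and invertibility supplies the
      witness that makes the chosen matrix a two-sided inverse.\<close>
    using assms unfolding matrix_inv_def invertible_def by (rule someI_ex[THEN conjunct1])
  then have "A *v (matrix_inv A *v axis l 1) = axis l 1"
    by (simp add: matrix_vector_mul_assoc)
  then have "(matrix_inv A *v axis l 1) $ k =
    det (\<chi> i j. if j = k then axis l 1 $ i else A $ i $ j) / det A"
    using assms by (simp add: cramer invertible_det_nz)
  then show ?thesis
    by (simp add: matrix_vector_mult_basis column_def)
qed

lemma tendsto_matrix_inv:
  fixes A :: "'b \<Rightarrow> real ^ 'n ^ 'n"
  assumes A: "(A \<longlongrightarrow> L) F" and L: "invertible L"
  shows "((\<lambda>x. matrix_inv (A x)) \<longlongrightarrow> matrix_inv L) F"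
proof (intro vec_tendstoI)
  fix k l
  let ?N = "\<lambda>B :: real ^ 'n ^ 'n. \<chi> i j. if j = k then axis l 1 $ i else B $ i $ j"
  \<comment> \<open>Cramer's formula is available only for invertible matrices. The determinants
    tend to \<open>det L\<close>, which is nonzero, so they are eventually nonzero.\<close>
  have ev: "eventually (\<lambda>x. invertible (A x)) F"
    using tendsto_imp_eventually_ne[OF tendsto_det[OF A]] L by (simp add: invertible_det_nz)
  have "((\<lambda>x. ?N (A x)) \<longlongrightarrow> ?N L) F"
    by (intro vec_tendstoI) (auto intro!: tendsto_intros A)
  then have "((\<lambda>x. det (?N (A x)) / det (A x)) \<longlongrightarrow> det (?N L) / det L) F"
    using L by (intro tendsto_divide tendsto_det A) (simp_all add: invertible_det_nz)
  then have "((\<lambda>x. det (?N (A x)) / det (A x)) \<longlongrightarrow> matrix_inv L $ k $ l) F"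
    by (simp add: matrix_inv_nth[OF L])
  then show "((\<lambda>x. matrix_inv (A x) $ k $ l) \<longlongrightarrow> matrix_inv L $ k $ l) F"
    by (rule Lim_transform_eventually)
      (use ev in \<open>eventually_elim, simp add: matrix_inv_nth\<close>)
qed

text \<open>Convergence of the factors is assumed in \<open>AE\<close> form so that inverses, whose
  convergence is derived almost everywhere, fit as well as the original factors.\<close>

lemma as_set_lim_bilinear_image:
  fixes prod :: "'a::real_normed_vector \<Rightarrow> 'b::real_normed_vector \<Rightarrow> 'c::real_normed_vector"
  assumes "bounded_bilinear prod" and "prob_space M" and "complete_measure M" and "compact K"
    and "AE \<omega> in M. (\<lambda>n. \<Psi> n \<omega>) \<longlonglongrightarrow> \<Psi>' \<omega>" and "as_set_lim M D D'"
    and "AE \<omega> in M. \<forall>n. D n \<omega> \<subseteq> K"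
  shows "as_set_lim M (\<lambda>n \<omega>. prod (\<Psi> n \<omega>) ` D n \<omega>) (\<lambda>\<omega>. prod (\<Psi>' \<omega>) ` D' \<omega>)"
proof -
  note AE_iff = prob_space.prob_Collect_eq_1_iff_AE[OF assms(2,3)]
  have "AE \<omega> in M. set_lim (\<lambda>n. D n \<omega>) (D' \<omega>)"
    using assms(6) by (simp add: as_set_lim_def AE_iff)
  with assms(5,7) show ?thesis
    unfolding as_set_lim_def AE_iff
    by eventually_elim (rule bounded_bilinear.set_lim_image[OF assms(1) _ _ \<open>compact K\<close>], auto)
qed

theorem corollary2:
  fixes M :: "'w measure"
    and C D :: "nat \<Rightarrow> 'w \<Rightarrow> (real ^ 'd) set"
    and C\<^sub>l\<^sub>i\<^sub>m D\<^sub>l\<^sub>i\<^sub>m :: "'w \<Rightarrow> (real ^ 'd) set"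
    and D\<^sub>0 :: "(real ^ 'd) set"
  assumes "prob_space M" and "complete_measure M"
    and "\<And>n. random_closed_set M (C n)" and "\<And>n. random_closed_set M (D n)"
    and "as_set_lim M C C\<^sub>l\<^sub>i\<^sub>m" and "as_set_lim M D D\<^sub>l\<^sub>i\<^sub>m"
    and "compact D\<^sub>0" and "\<And>n. \<P>(\<omega> in M. D n \<omega> \<subseteq> D\<^sub>0) = 1"
  shows
    "as_set_lim M (\<lambda>n \<omega>. C n \<omega> + D n \<omega>) (\<lambda>\<omega>. C\<^sub>l\<^sub>i\<^sub>m \<omega> + D\<^sub>l\<^sub>i\<^sub>m \<omega>) \<and>
     (\<P>(\<omega> in M. D\<^sub>l\<^sub>i\<^sub>m \<omega> \<noteq> {}) = 1 \<longrightarrow>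
        as_set_limsup_subset M (\<lambda>n \<omega>. C n \<omega> \<ominus> D n \<omega>) (\<lambda>\<omega>. C\<^sub>l\<^sub>i\<^sub>m \<omega> \<ominus> D\<^sub>l\<^sub>i\<^sub>m \<omega>)) \<and>
     (\<forall>(\<Psi> :: nat \<Rightarrow> 'w \<Rightarrow> real ^ 'd ^ 'm) \<Psi>\<^sub>l\<^sub>i\<^sub>m. as_lim M \<Psi> \<Psi>\<^sub>l\<^sub>i\<^sub>m \<longrightarrow>
        as_set_lim M (\<lambda>n \<omega>. (*v) (\<Psi> n \<omega>) ` D n \<omega>) (\<lambda>\<omega>. (*v) (\<Psi>\<^sub>l\<^sub>i\<^sub>m \<omega>) ` D\<^sub>l\<^sub>i\<^sub>m \<omega>)) \<and>
     (\<forall>(\<psi> :: nat \<Rightarrow> 'w \<Rightarrow> real) \<psi>\<^sub>l\<^sub>i\<^sub>m. as_lim M \<psi> \<psi>\<^sub>l\<^sub>i\<^sub>m \<longrightarrow>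
        as_set_lim M (\<lambda>n \<omega>. (*\<^sub>R) (\<psi> n \<omega>) ` D n \<omega>) (\<lambda>\<omega>. (*\<^sub>R) (\<psi>\<^sub>l\<^sub>i\<^sub>m \<omega>) ` D\<^sub>l\<^sub>i\<^sub>m \<omega>)) \<and>
     (\<forall>(\<Psi> :: nat \<Rightarrow> 'w \<Rightarrow> real ^ 'd ^ 'd) \<Psi>\<^sub>l\<^sub>i\<^sub>m. as_lim M \<Psi> \<Psi>\<^sub>l\<^sub>i\<^sub>m \<longrightarrow>
        \<P>(\<omega> in M. invertible (\<Psi>\<^sub>l\<^sub>i\<^sub>m \<omega>)) = 1 \<longrightarrow>
        as_set_lim M (\<lambda>n \<omega>. (*v) (matrix_inv (\<Psi> n \<omega>)) ` D n \<omega>)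
          (\<lambda>\<omega>. (*v) (matrix_inv (\<Psi>\<^sub>l\<^sub>i\<^sub>m \<omega>)) ` D\<^sub>l\<^sub>i\<^sub>m \<omega>)) \<and>
     (\<forall>(\<psi> :: nat \<Rightarrow> 'w \<Rightarrow> real) \<psi>\<^sub>l\<^sub>i\<^sub>m. as_lim M \<psi> \<psi>\<^sub>l\<^sub>i\<^sub>m \<longrightarrow>
        \<P>(\<omega> in M. \<psi>\<^sub>l\<^sub>i\<^sub>m \<omega> \<noteq> 0) = 1 \<longrightarrow>
        as_set_lim M (\<lambda>n \<omega>. (*\<^sub>R) (inverse (\<psi> n \<omega>)) ` D n \<omega>)
          (\<lambda>\<omega>. (*\<^sub>R) (inverse (\<psi>\<^sub>l\<^sub>i\<^sub>m \<omega>)) ` D\<^sub>l\<^sub>i\<^sub>m \<omega>))"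
proof (intro conjI allI impI)
  interpret prob_space M by fact
  note AE_iff = prob_Collect_eq_1_iff_AE[OF assms(2)]
  note as_defs = as_set_lim_def as_set_limsup_subset_def as_lim_def AE_iff
  have C: "AE \<omega> in M. set_lim (\<lambda>n. C n \<omega>) (C\<^sub>l\<^sub>i\<^sub>m \<omega>)"
    and D: "AE \<omega> in M. set_lim (\<lambda>n. D n \<omega>) (D\<^sub>l\<^sub>i\<^sub>m \<omega>)"
    using assms(5,6) by (simp_all add: as_defs)
  \<comment> \<open>The bound is given for each \<open>n\<close> separately; a countable union of
    null sets is null, so one exceptional set serves all \<open>n\<close>.\<close>
  have D\<^sub>0: "AE \<omega> in M. \<forall>n. D n \<omega> \<subseteq> D\<^sub>0"
    using assms(8) by (simp add: AE_iff AE_all_countable)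
  show "as_set_lim M (\<lambda>n \<omega>. C n \<omega> + D n \<omega>) (\<lambda>\<omega>. C\<^sub>l\<^sub>i\<^sub>m \<omega> + D\<^sub>l\<^sub>i\<^sub>m \<omega>)"
    unfolding as_defs using C D D\<^sub>0
    by eventually_elim (rule set_lim_plus[OF _ _ \<open>compact D\<^sub>0\<close>], auto)
  show "as_set_limsup_subset M (\<lambda>n \<omega>. C n \<omega> \<ominus> D n \<omega>) (\<lambda>\<omega>. C\<^sub>l\<^sub>i\<^sub>m \<omega> \<ominus> D\<^sub>l\<^sub>i\<^sub>m \<omega>)"
    unfolding as_defs using C D
    \<comment> \<open>At almost every sample point the limit of the \<open>C n\<close> is their
      upper limit and that of the \<open>D n\<close> is their lower limit, as the pointwise
      inclusion requires.\<close>
    by eventually_elim (rule order_trans[OF set_limsup_minkowski_diff], simp add: set_lim_def)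
  note image = as_set_lim_bilinear_image[OF _ assms(1,2,7) _ assms(6) D\<^sub>0]
  note mult_image = image[OF bounded_bilinear_matrix_vector_mult]
    and scaleR_image = image[OF bounded_bilinear_scaleR]
  show "as_set_lim M (\<lambda>n \<omega>. (*v) (\<Psi> n \<omega>) ` D n \<omega>) (\<lambda>\<omega>. (*v) (\<Psi>\<^sub>l\<^sub>i\<^sub>m \<omega>) ` D\<^sub>l\<^sub>i\<^sub>m \<omega>)"
    if "as_lim M \<Psi> \<Psi>\<^sub>l\<^sub>i\<^sub>m" for \<Psi> :: "nat \<Rightarrow> 'w \<Rightarrow> real ^ 'd ^ 'm" and \<Psi>\<^sub>l\<^sub>i\<^sub>m
    using that by (intro mult_image) (simp add: as_defs)
  show "as_set_lim M (\<lambda>n \<omega>. (*\<^sub>R) (\<psi> n \<omega>) ` D n \<omega>) (\<lambda>\<omega>. (*\<^sub>R) (\<psi>\<^sub>l\<^sub>i\<^sub>m \<omega>) ` D\<^sub>l\<^sub>i\<^sub>m \<omega>)"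
    if "as_lim M \<psi> \<psi>\<^sub>l\<^sub>i\<^sub>m" for \<psi> :: "nat \<Rightarrow> 'w \<Rightarrow> real" and \<psi>\<^sub>l\<^sub>i\<^sub>m
    using that by (intro scaleR_image) (simp add: as_defs)
  show "as_set_lim M (\<lambda>n \<omega>. (*v) (matrix_inv (\<Psi> n \<omega>)) ` D n \<omega>)
      (\<lambda>\<omega>. (*v) (matrix_inv (\<Psi>\<^sub>l\<^sub>i\<^sub>m \<omega>)) ` D\<^sub>l\<^sub>i\<^sub>m \<omega>)"
    if "as_lim M \<Psi> \<Psi>\<^sub>l\<^sub>i\<^sub>m" and "\<P>(\<omega> in M. invertible (\<Psi>\<^sub>l\<^sub>i\<^sub>m \<omega>)) = 1"
    for \<Psi> :: "nat \<Rightarrow> 'w \<Rightarrow> real ^ 'd ^ 'd" and \<Psi>\<^sub>l\<^sub>i\<^sub>m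
  proof (rule mult_image)
    show "AE \<omega> in M. (\<lambda>n. matrix_inv (\<Psi> n \<omega>)) \<longlonglongrightarrow> matrix_inv (\<Psi>\<^sub>l\<^sub>i\<^sub>m \<omega>)"
      using that unfolding as_lim_def AE_iff by eventually_elim (rule tendsto_matrix_inv)
  qed
  show "as_set_lim M (\<lambda>n \<omega>. (*\<^sub>R) (inverse (\<psi> n \<omega>)) ` D n \<omega>)
      (\<lambda>\<omega>. (*\<^sub>R) (inverse (\<psi>\<^sub>l\<^sub>i\<^sub>m \<omega>)) ` D\<^sub>l\<^sub>i\<^sub>m \<omega>)"
    if "as_lim M \<psi> \<psi>\<^sub>l\<^sub>i\<^sub>m" and "\<P>(\<omega> in M. \<psi>\<^sub>l\<^sub>i\<^sub>m \<omega> \<noteq> 0) = 1"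
    for \<psi> :: "nat \<Rightarrow> 'w \<Rightarrow> real" and \<psi>\<^sub>l\<^sub>i\<^sub>m
  proof (rule scaleR_image)
    show "AE \<omega> in M. (\<lambda>n. inverse (\<psi> n \<omega>)) \<longlonglongrightarrow> inverse (\<psi>\<^sub>l\<^sub>i\<^sub>m \<omega>)"
      using that unfolding as_lim_def AE_iff by eventually_elim (rule tendsto_inverse)
  qed
qed

end
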